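(* Let $n\ge 1$ and let $\mu$ be a probability measure on $\Omega=\{0,1\}^{[n]}$ whose rank sequence $(\mu(|\eta|=i))_{i=0}^n$ has no internal zeros. If $\mu$ has the conditional antipodal pairs property (CAPP), then $\mu$ is ultra-log-concave (ULC).
   Context: For a finite set $S$, let $\mathcal{M}_S$ denote the set of probability measures on $\{0,1\}^S$; for $\eta\in\{0,1\}^S$ write $|\eta|=\sum_i\eta_i$ and $\mathbf{1}=(1,\dots,1)$. The rank sequence of $\nu\in\mathcal{M}_S$ is $(\nu(|\eta|=i))_{i=0}^{|S|}$. A nonnegative sequence $(a_0,\dots,a_m)$ has no internal zeros if $\{i:a_i\neq 0\}$ is an interval; it is log-concave if $a_i^2\ge a_{i-1}a_{i+1}$ for $1\le i\le m-1$; it is ULC if $(a_i/\binom{m}{i})_{i=0}^m$ is log-concave and has no internal zeros. A measure is ULC if its rank sequence is ULC. For $\nu\in\mathcal{M}_S$ with $|S|=m$ set $\gamma_i(\nu)=\binom{m}{i}^{-1}\sum\{\nu(\eta)\nu(\mathbf{1}-\eta):\eta\in\{0,1\}^S,|\eta|=i\}$. A measure $\nu$ on $\{0,1\}^S$ with $|S|=2k$ has the antipodal pairs property (APP) if $\gamma_k(\nu)\ge\gamma_{k-1}(\nu)$. Conditioning $\mu$ means passing to a measure $\mu(\cdot\mid \eta_i=\xi_i\ \forall i\in I)$ for some $I\subseteq[n]$ and $\xi\in\{0,1\}^I$ with $\mu(\eta_i=\xi_i\ \forall i\in I)>0$, regarded as a measure on $\{0,1\}^{[n]\setminus I}$. $\mu$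 has the CAPP if every measure obtained from $\mu$ by conditioning on the values of some $n-2k$ coordinates (for some $k$) has the APP. *)

theory Defs
  imports "HOL-Probability.Probability"
begin

text \<open>
  Configurations in $\{0,1\}^S$ are extensional functions, so that the function outside \<open>S\<close> carries no
  information. As $\{0,1\}^S$ is finite, its probability measures are the probability mass
  functions supported on it.
\<close>

definition cube :: "'a set \<Rightarrow> ('a \<Rightarrow> nat) set" where
  "cube S = S \<rightarrow>\<^sub>E {0, 1}"

definition prob_measures :: "'a set \<Rightarrow> ('a \<Rightarrow> nat) pmf set" where
  "prob_measures S = {\<nu>. set_pmf \<nu> \<subseteq> cube S}"

definition weight :: "'a set \<Rightarrow> ('a \<Rightarrow> nat) \<Rightarrow> nat" where
  "weight S \<eta> = (\<Sum>i\<in>S. \<eta> i)"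

definition antipode :: "'a set \<Rightarrow> ('a \<Rightarrow> nat) \<Rightarrow> ('a \<Rightarrow> nat)" where
  "antipode S \<eta> = (\<lambda>i\<in>S. 1 - \<eta> i)"

definition rank_sequence :: "'a set \<Rightarrow> ('a \<Rightarrow> nat) pmf \<Rightarrow> nat \<Rightarrow> real" where
  "rank_sequence S \<nu> i = measure_pmf.prob \<nu> {\<eta> \<in> cube S. weight S \<eta> = i}"

text \<open>
  A finite sequence $(a_0,\dots,a_m)$ is a function on the naturals together with its last
  index \<open>m\<close>; values beyond \<open>m\<close> are ignored. The sequences of interest are nonnegative.
\<close>

definition no_internal_zeros :: "nat \<Rightarrow> (nat \<Rightarrow> real) \<Rightarrow> bool" where
  "no_internal_zeros m a \<longleftrightarrow> (\<exists>l u. {i \<in> {0..m}. a i \<noteq> 0} = {l..u})"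

definition log_concave_seq :: "nat \<Rightarrow> (nat \<Rightarrow> real) \<Rightarrow> bool" where
  "log_concave_seq m a \<longleftrightarrow> (\<forall>i\<in>{1..<m}. (a i)\<^sup>2 \<ge> a (i - 1) * a (i + 1))"

definition ULC_seq :: "nat \<Rightarrow> (nat \<Rightarrow> real) \<Rightarrow> bool" where
  "ULC_seq m a \<longleftrightarrow>
     log_concave_seq m (\<lambda>i. a i / real (m choose i)) \<and>
     no_internal_zeros m (\<lambda>i. a i / real (m choose i))"

definition ULC :: "'a set \<Rightarrow> ('a \<Rightarrow> nat) pmf \<Rightarrow> bool" where
  "ULC S \<nu> \<longleftrightarrow> ULC_seq (card S) (rank_sequence S \<nu>)"

definition antipodal_avg :: "'a set \<Rightarrow> ('a \<Rightarrow> nat) pmf \<Rightarrow> nat \<Rightarrow> real" where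
  "antipodal_avg S \<nu> i =
     (\<Sum>\<eta> | \<eta> \<in> cube S \<and> weight S \<eta> = i. pmf \<nu> \<eta> * pmf \<nu> (antipode S \<eta>))
       / real (card S choose i)"

text \<open>
  For \<open>k = 0\<close> the condition is trivially true, in agreement with reading $\gamma_{-1}$ as an
  empty sum.
\<close>

definition APP :: "'a set \<Rightarrow> ('a \<Rightarrow> nat) pmf \<Rightarrow> bool" where
  "APP S \<nu> \<longleftrightarrow>
     (\<exists>k. card S = 2 * k \<and> antipodal_avg S \<nu> k \<ge> antipodal_avg S \<nu> (k - 1))"

definition cylinder :: "'a set \<Rightarrow> 'a set \<Rightarrow> ('a \<Rightarrow> nat) \<Rightarrow> ('a \<Rightarrow> nat) set" where
  "cylinder S I \<xi> = {\<eta> \<in> cube S. \<forall>i\<in>I. \<eta> i = \<xi> i}"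

text \<open>Meaningful only when the cylinder has positive probability.\<close>

definition conditional ::
  "'a set \<Rightarrow> 'a set \<Rightarrow> ('a \<Rightarrow> nat) \<Rightarrow> ('a \<Rightarrow> nat) pmf \<Rightarrow> ('a \<Rightarrow> nat) pmf" where
  "conditional S I \<xi> \<mu> = map_pmf (\<lambda>\<eta>. restrict \<eta> (S - I)) (cond_pmf \<mu> (cylinder S I \<xi>))"

definition CAPP :: "'a set \<Rightarrow> ('a \<Rightarrow> nat) pmf \<Rightarrow> bool" where
  "CAPP S \<mu> \<longleftrightarrow>
     (\<forall>I \<xi> k. I \<subseteq> S \<longrightarrow> card I + 2 * k = card S \<longrightarrow> \<xi> \<in> cube I \<longrightarrow>
        measure_pmf.prob \<mu> (cylinder S I \<xi>) > 0 \<longrightarrow>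
        APP (S - I) (conditional S I \<xi> \<mu>))"

lemma conditional_in_prob_measures:
  assumes "measure_pmf.prob \<mu> (cylinder S I \<xi>) > 0"
  shows "conditional S I \<xi> \<mu> \<in> prob_measures (S - I)"
proof -
  have "set_pmf \<mu> \<inter> cylinder S I \<xi> \<noteq> {}"
    using assms by (auto simp: measure_pmf_zero_iff zero_less_measure_iff)
  then have "set_pmf (cond_pmf \<mu> (cylinder S I \<xi>)) \<subseteq> cube S"
    by (auto simp: set_cond_pmf cylinder_def)
  then show ?thesis
    unfolding conditional_def prob_measures_def cube_def
    by (auto simp: restrict_PiE_iff dest!: subsetD dest: PiE_mem)
qed

end

theory Submission
  imports Defs
begin

text \<open>
  Identify configurations with subsets of $S$ and write $a_i$ for the mass of the layer
  $|x| = i$. Sorting the pairs $(x, y)$ in $a_{i-1} a_{i+1}$ by $z = x \cap y$ and the symmetric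
  difference $D$, the property for $\mu$ conditioned on being $z$ off $D$ gives
  \[ a_{i-1} a_{i+1} \le \sum_{|x| = |y| = i} \Bigl(1 - \frac{1}{|x \setminus y| + 1}\Bigr) \mu(x) \mu(y). \]
  The kernel $1/(|x \setminus y| + 1)$ is positive semidefinite: it equals
  $\sum_{U \subseteq x \cap y} \bigl((i+1) {i \choose |U|}\bigr)^{-1}$. Cauchy--Schwarz over the sets $U$ of
  each fixed size bounds its quadratic form below by
  $\frac{n+1}{(i+1)(n-i+1)} a_i^2$, with equality for the uniform measure, and this is exactly
  what ultra-log-concavity needs.
\<close>

section \<open>Binomial sums and the quadratic form of the kernel
  \<open>1 / (card (x - y) + 1)\<close>\<close>

text \<open>Absorption (t + 1) C(s + 1, t + 1) = (s + 1) C(s, t) in numerator and denominator makes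
  every term but the first a constant multiple of a term for j - 1 and i - 1, whence the induction.
  The identity serves twice: with j the size of an intersection it evaluates the kernel, and with
  the layer i inside n it produces the final constant.\<close>

lemma sum_binomial_ratio:
  fixes i j :: nat
  assumes "j \<le> i"
  shows "(\<Sum>u\<le>j. real (j choose u) / real (i choose u)) = real (i + 1) / real (i + 1 - j)"
  using assms
proof (induction j arbitrary: i)
  case 0
  then show ?case by simp
next
  case (Suc j)
  then obtain h where i: "i = Suc h" and jh: "j \<le> h"
    by (cases i) auto
  have step: "real (Suc j choose Suc u) / real (i choose Suc u)
      = real (j + 1) / real (h + 1) * (real (j choose u) / real (h choose u))" for u
  proof -
    have "real (Suc j choose Suc u) = real (Suc j) * real (j choose u) / real (Suc u)"
      using Suc_times_binomial_eq[of j u] by (simp add: field_simps flip: of_nat_mult of_nat_Suc)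
    moreover have "real (Suc h choose Suc u) = real (Suc h) * real (h choose u) / real (Suc u)"
      using Suc_times_binomial_eq[of h u] by (simp add: field_simps flip: of_nat_mult of_nat_Suc)
    ultimately show ?thesis
      unfolding i by simp
  qed
  have "(\<Sum>u\<le>Suc j. real (Suc j choose u) / real (i choose u))
      = 1 + (\<Sum>u\<le>j. real (Suc j choose Suc u) / real (i choose Suc u))"
    by (subst sum.atMost_Suc_shift) simp
  also have "\<dots> = 1 + real (j + 1) / real (h + 1) * (real (h + 1) / real (h + 1 - j))"
    unfolding step sum_distrib_left[symmetric] Suc.IH[OF jh] ..
  also have "\<dots> = real (i + 1) / real (i + 1 - Suc j)"
  proof -
    obtain m where "h = j + m" using jh le_Suc_ex by blast
    moreover have "real (j + 1) / real (h + 1) * (real (h + 1) / real (h + 1 - j))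
        = real (j + 1) / real (h + 1 - j)"
      by simp
    ultimately show ?thesis by (simp add: i field_simps)
  qed
  finally show ?case .
qed

text \<open>Group the subsets U by size and apply \<open>sum_binomial_ratio\<close> with j =
  \<open>card (x \<inter> y)\<close>; then i + 1 - j is \<open>card (x - y) + 1\<close>. Writing the
  kernel as a positive combination of products [U \<subseteq> x] [U \<subseteq> y] exhibits its
  positive semidefiniteness.\<close>

lemma inverse_Suc_card_Diff:
  assumes "finite x" "card x = i"
  shows "1 / (real (card (x - y)) + 1)
    = (\<Sum>U | U \<subseteq> x \<inter> y. 1 / (real (i + 1) * real (i choose card U)))"
proof -
  let ?j = "card (x \<inter> y)"
  have fin: "finite (x \<inter> y)" using assms by simp
  have ji: "?j \<le> i" using assms card_mono[of x "x \<inter> y"] by auto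
  have "card (x - y) = i - ?j" using assms by (simp add: card_Diff_subset_Int)
  then have *: "real (card (x - y)) + 1 = real (i + 1 - ?j)" using ji by simp
  have "(\<Sum>U | U \<subseteq> x \<inter> y. 1 / (real (i + 1) * real (i choose card U)))
     = (\<Sum>u\<le>?j. \<Sum>U | U \<in> {U. U \<subseteq> x \<inter> y} \<and> card U = u.
          1 / (real (i + 1) * real (i choose card U)))"
    using finite_Collect_subsets[OF fin] card_mono[OF fin] by (intro sum.group[symmetric]) auto
  also have "\<dots> = (\<Sum>u\<le>?j. real (?j choose u) / real (i choose u)) / real (i + 1)"
    using n_subsets[OF fin] by (simp add: sum_divide_distrib field_simps)
  also have "\<dots> = 1 / real (i + 1 - ?j)"
    unfolding sum_binomial_ratio[OF ji] by simp
  finally show ?thesis unfolding * by simp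
qed

text \<open>Double counting: a set x of size i has C(i, u) subsets U of size u.\<close>

lemma sum_sets_containing_in_layer:
  fixes p :: "'a set \<Rightarrow> real"
  assumes "finite S"
  shows "(\<Sum>U | U \<subseteq> S \<and> card U = u. \<Sum>x | x \<subseteq> S \<and> card x = i \<and> U \<subseteq> x. p x)
    = real (i choose u) * (\<Sum>x | x \<subseteq> S \<and> card x = i. p x)"
proof -
  have "(\<Sum>U | U \<subseteq> S \<and> card U = u. \<Sum>x | x \<subseteq> S \<and> card x = i \<and> U \<subseteq> x. p x)
     = (\<Sum>U | U \<subseteq> S \<and> card U = u. \<Sum>x | x \<in> {x. x \<subseteq> S \<and> card x = i} \<and> U \<subseteq> x. p x)"
    by (simp add: conj_assoc)
  also have "\<dots> = (\<Sum>x | x \<subseteq> S \<and> card x = i.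
      \<Sum>U | U \<in> {U. U \<subseteq> S \<and> card U = u} \<and> U \<subseteq> x. p x)"
    using assms by (intro sum.swap_restrict) auto
  also have "\<dots> = (\<Sum>x | x \<subseteq> S \<and> card x = i. real (i choose u) * p x)"
  proof (rule sum.cong[OF refl])
    fix x assume x: "x \<in> {x. x \<subseteq> S \<and> card x = i}"
    then have "{U. U \<in> {U. U \<subseteq> S \<and> card U = u} \<and> U \<subseteq> x} = {U. U \<subseteq> x \<and> card U = u}"
      by auto
    with x n_subsets[of x u] finite_subset[OF _ assms, of x]
    show "(\<Sum>U | U \<in> {U. U \<subseteq> S \<and> card U = u} \<and> U \<subseteq> x. p x) = real (i choose u) * p x"
      by simp
  qed
  finally show ?thesis by (simp add: sum_distrib_left)
qed

text \<open>Expanding the kernel turns the form into the sum of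
  \<open>c (card U) * (T U)\<^sup>2\<close>, where \<open>T U\<close> is the mass of the sets in the
  layer that contain U. For each size u the total of \<open>T U\<close> is C(i, u) a, so
  Cauchy-Schwarz over the C(n, u) sets bounds that size from below, and
  \<open>sum_binomial_ratio\<close> adds up the bounds.\<close>

lemma inverse_distance_form_lower_bound:
  fixes p :: "'a set \<Rightarrow> real"
  assumes "finite S" "card S = n" "i \<le> n"
  defines "L \<equiv> {x. x \<subseteq> S \<and> card x = i}"
  shows "(\<Sum>x\<in>L. \<Sum>y\<in>L. p x * p y / (real (card (x - y)) + 1))
    \<ge> real (n + 1) / (real (i + 1) * real (n + 1 - i)) * (\<Sum>x\<in>L. p x)\<^sup>2"
proof -
  define T where "T U = (\<Sum>x | x \<in> L \<and> U \<subseteq> x. p x)" for U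
  define c where "c u = 1 / (real (i + 1) * real (i choose u))" for u
  define a where "a = (\<Sum>x\<in>L. p x)"
  have finL: "finite L" using assms by (simp add: L_def)
  have finx: "finite x" "card x = i" "x \<subseteq> S" if "x \<in> L" for x
    using that assms finite_subset by (auto simp: L_def)
  \<comment> \<open>A common index set for all pairs: subsets of x in \<open>L\<close> have size at
    most i. Containment in x and y moves into an \<open>if\<close>, so the three sums can be
    interchanged freely.\<close>
  define P where "P = {U. U \<subseteq> S \<and> card U \<le> i}"
  have finP: "finite P" using assms by (simp add: P_def)
  have "(\<Sum>x\<in>L. \<Sum>y\<in>L. p x * p y / (real (card (x - y)) + 1))
      = (\<Sum>x\<in>L. \<Sum>y\<in>L. \<Sum>U\<in>P. if U \<subseteq> x \<and> U \<subseteq> y then c (card U) * p x * p y else 0)"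
  proof (intro sum.cong refl)
    fix x y assume x: "x \<in> L" and y: "y \<in> L"
    have "{U. U \<subseteq> x \<inter> y} = {U \<in> P. U \<subseteq> x \<and> U \<subseteq> y}"
      using finx[OF x] card_mono[of x] by (auto simp: P_def)
    then have "1 / (real (card (x - y)) + 1) = (\<Sum>U \<in> {U \<in> P. U \<subseteq> x \<and> U \<subseteq> y}. c (card U))"
      using inverse_Suc_card_Diff[of x i y] finx[OF x] by (simp add: c_def)
    also have "\<dots> = (\<Sum>U\<in>P. if U \<subseteq> x \<and> U \<subseteq> y then c (card U) else 0)"
      using finP by (rule sum.inter_filter)
    finally have "p x * p y / (real (card (x - y)) + 1)
       = p x * p y * (\<Sum>U\<in>P. if U \<subseteq> x \<and> U \<subseteq> y then c (card U) else 0)"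
      by (simp add: divide_inverse)
    also have "\<dots> = (\<Sum>U\<in>P. if U \<subseteq> x \<and> U \<subseteq> y then c (card U) * p x * p y else 0)"
      by (auto simp: sum_distrib_left intro!: sum.cong)
    finally show "p x * p y / (real (card (x - y)) + 1)
      = (\<Sum>U\<in>P. if U \<subseteq> x \<and> U \<subseteq> y then c (card U) * p x * p y else 0)" .
  qed
  also have "\<dots> = (\<Sum>x\<in>L. \<Sum>U\<in>P. \<Sum>y\<in>L. if U \<subseteq> x \<and> U \<subseteq> y then c (card U) * p x * p y else 0)"
    by (intro sum.cong refl sum.swap)
  also have "\<dots> = (\<Sum>U\<in>P. \<Sum>x\<in>L. \<Sum>y\<in>L. if U \<subseteq> x \<and> U \<subseteq> y then c (card U) * p x * p y else 0)"
    by (rule sum.swap)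
  also have "\<dots> = (\<Sum>U\<in>P. c (card U) * (T U)\<^sup>2)"
  proof (intro sum.cong refl)
    fix U
    have T: "T U = (\<Sum>x\<in>L. if U \<subseteq> x then p x else 0)"
      unfolding T_def using finL by (simp add: sum.inter_filter)
    have "c (card U) * (T U)\<^sup>2
      = (\<Sum>x\<in>L. \<Sum>y\<in>L. c (card U) * ((if U \<subseteq> x then p x else 0) * (if U \<subseteq> y then p y else 0)))"
      unfolding T power2_eq_square sum_product by (simp only: sum_distrib_left)
    also have "\<dots> = (\<Sum>x\<in>L. \<Sum>y\<in>L. if U \<subseteq> x \<and> U \<subseteq> y then c (card U) * p x * p y else 0)"
      by (intro sum.cong refl) auto
    finally show "(\<Sum>x\<in>L. \<Sum>y\<in>L. if U \<subseteq> x \<and> U \<subseteq> y then c (card U) * p x * p y else 0)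
        = c (card U) * (T U)\<^sup>2" ..
  qed
  also have "\<dots> = (\<Sum>u\<le>i. \<Sum>U | U \<in> P \<and> card U = u. c (card U) * (T U)\<^sup>2)"
    using finP by (intro sum.group[symmetric]) (auto simp: P_def)
  also have "\<dots> \<ge> (\<Sum>u\<le>i. a\<^sup>2 / real (i + 1) * (real (i choose u) / real (n choose u)))"
  proof (rule sum_mono)
    fix u assume "u \<in> {..i}"
    then have ui: "u \<le> i" by simp
    let ?V = "{U. U \<subseteq> S \<and> card U = u}"
    have V: "{U. U \<in> P \<and> card U = u} = ?V" using ui by (auto simp: P_def)
    have cardV: "card ?V = n choose u" using n_subsets assms by metis
    have pos: "real (i choose u) > 0" "real (n choose u) > 0" using ui assms by auto
    have "(\<Sum>U\<in>?V. T U) = real (i choose u) * a"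
      using sum_sets_containing_in_layer[OF assms(1), where i=i and u=u and p=p]
      by (simp add: T_def L_def a_def conj_assoc)
    \<comment> \<open>Cauchy-Schwarz against the constant function 1 on the sets of size u.\<close>
    then have "(real (i choose u) * a)\<^sup>2 \<le> real (n choose u) * (\<Sum>U\<in>?V. (T U)\<^sup>2)"
      using sum_squared_le_sum_of_squares[of T ?V] cardV assms(1)
      by (simp add: mult.commute)
    then have "real (i choose u) * a\<^sup>2 / real (n choose u)
        \<le> (\<Sum>U\<in>?V. (T U)\<^sup>2) / real (i choose u)"
      using pos by (simp add: field_simps power2_eq_square)
    then have "real (i choose u) * a\<^sup>2 / real (n choose u) / real (i + 1)
        \<le> (\<Sum>U\<in>?V. (T U)\<^sup>2) / real (i choose u) / real (i + 1)"
      by (rule divide_right_mono) simp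
    also have "\<dots> = (\<Sum>U\<in>?V. c (card U) * (T U)\<^sup>2)"
      by (simp add: c_def sum_divide_distrib mult.commute)
    finally show "a\<^sup>2 / real (i + 1) * (real (i choose u) / real (n choose u))
        \<le> (\<Sum>U | U \<in> P \<and> card U = u. c (card U) * (T U)\<^sup>2)"
      unfolding V by (simp add: mult.commute)
  qed
  also have "(\<Sum>u\<le>i. a\<^sup>2 / real (i + 1) * (real (i choose u) / real (n choose u)))
     = real (n + 1) / (real (i + 1) * real (n + 1 - i)) * a\<^sup>2"
    unfolding sum_distrib_left[symmetric] sum_binomial_ratio[OF assms(3)] by simp
  finally show ?thesis unfolding a_def .
qed

section \<open>From antipodal pairs to neighbouring layers\<close>

text \<open>A pair (x, y) is determined by its symmetric difference D, its intersection z and w = x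
  - y. For fixed D and z, the two members agree off D and are antipodal on D, which is the form in
  which conditioning sees them.\<close>

lemma sum_pairs_by_Int_and_sym_diff:
  fixes f :: "'a set \<Rightarrow> 'a set \<Rightarrow> real"
  assumes "finite S"
  shows "(\<Sum>x\<in>Pow S. \<Sum>y\<in>Pow S. f x y)
    = (\<Sum>D\<in>Pow S. \<Sum>z\<in>Pow (S - D). \<Sum>w\<in>Pow D. f (z \<union> w) (z \<union> (D - w)))"
proof -
  have fin: "finite D" if "D \<subseteq> S" for D using that assms finite_subset by blast
  have "(\<Sum>D\<in>Pow S. \<Sum>z\<in>Pow (S - D). \<Sum>w\<in>Pow D. f (z \<union> w) (z \<union> (D - w)))
     = (\<Sum>(D, z, w)\<in>(SIGMA D:Pow S. Pow (S - D) \<times> Pow D). f (z \<union> w) (z \<union> (D - w)))"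
    using assms fin by (simp add: sum.cartesian_product sum.Sigma)
  also have "\<dots> = (\<Sum>(x, y)\<in>Pow S \<times> Pow S. f x y)"
    by (rule sum.reindex_bij_witness[of _ "\<lambda>(x, y). ((x - y) \<union> (y - x), x \<inter> y, x - y)"
          "\<lambda>(D, z, w). (z \<union> w, z \<union> (D - w))"])
       (auto; fail | force)+
  finally show ?thesis by (simp add: sum.cartesian_product)
qed

text \<open>The assumption on pairs is the APP for the conditioned weights with binomials cleared,
  as k C(2k, k) = (k + 1) C(2k, k - 1). Applied to each fixed D and z it moves pairs from layers i -
  1 and i + 1 to layer i at the price k / (k + 1) = 1 - 1 / (k + 1), where k =
  \<open>card (x - y)\<close>. The bound on the kernel then applies to the sum of these
  prices.\<close>

lemma layers_ultra_log_concave: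
  fixes p :: "'a set \<Rightarrow> real"
  assumes "finite S" "card S = n" "1 \<le> i" "i < n"
    and nonneg: "\<And>x. p x \<ge> 0"
    and pairs: "\<And>D z k. D \<subseteq> S \<Longrightarrow> z \<subseteq> S - D \<Longrightarrow> card D = 2 * k \<Longrightarrow> k \<ge> 1 \<Longrightarrow>
      real (k + 1) * (\<Sum>w | w \<subseteq> D \<and> card w = k - 1. p (z \<union> w) * p (z \<union> (D - w)))
        \<le> real k * (\<Sum>w | w \<subseteq> D \<and> card w = k. p (z \<union> w) * p (z \<union> (D - w)))"
  defines "a \<equiv> \<lambda>j. \<Sum>x | x \<subseteq> S \<and> card x = j. p x"
  shows "a (i - 1) * a (i + 1) \<le> real i * real (n - i) / (real (i + 1) * real (n - i + 1)) * (a i)\<^sup>2"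
proof -
  define f where "f x y = (if card x = i - 1 \<and> card y = i + 1 then p x * p y else 0)" for x y
  define g where "g x y = (if card x = i \<and> card y = i then
      (1 - 1 / (real (card (x - y)) + 1)) * (p x * p y) else 0)" for x y
  let ?L = "{x. x \<subseteq> S \<and> card x = i}"
  have finP: "finite (Pow S)" using assms by simp
  have layer: "(\<Sum>x\<in>Pow S. if card x = j then h x else 0) = (\<Sum>x | x \<subseteq> S \<and> card x = j. h x)"
    for h :: "'a set \<Rightarrow> real" and j
    using sum.inter_filter[OF finP, of h "\<lambda>x. card x = j"] by simp
  have layer2: "(\<Sum>x\<in>Pow S. \<Sum>y\<in>Pow S. if card x = j \<and> card y = l then h x y else 0)
     = (\<Sum>x | x \<subseteq> S \<and> card x = j. \<Sum>y | y \<subseteq> S \<and> card y = l. h x y)"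
    for h :: "'a set \<Rightarrow> 'a set \<Rightarrow> real" and j l
    unfolding layer[symmetric] by (intro sum.cong refl) (auto intro: sum.cong)
  have "a (i - 1) * a (i + 1) = (\<Sum>x\<in>Pow S. \<Sum>y\<in>Pow S. f x y)"
    unfolding f_def layer2 a_def sum_product ..
  also have "\<dots> \<le> (\<Sum>x\<in>Pow S. \<Sum>y\<in>Pow S. g x y)"
    unfolding sum_pairs_by_Int_and_sym_diff[OF assms(1)]
  proof (rule sum_mono, rule sum_mono)
    fix D z assume "D \<in> Pow S" "z \<in> Pow (S - D)"
    then have D: "D \<subseteq> S" and z: "z \<subseteq> S - D" by auto
    have finD: "finite D" and finz: "finite z" using D z assms(1) finite_subset by blast+
    have gnn: "g x y \<ge> 0" for x y
      using nonneg by (simp add: g_def divide_simps)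
    have c1: "card (z \<union> w) = card z + card w" and c2: "card (z \<union> (D - w)) = card z + (card D - card w)"
      and c3: "card w \<le> card D" and c4: "(z \<union> w) - (z \<union> (D - w)) = w"
      if "w \<in> Pow D" for w
    proof -
      have w: "w \<subseteq> D" "finite w" using that finD finite_subset by auto
      show "card (z \<union> w) = card z + card w"
        using w z finz by (intro card_Un_disjoint) auto
      have "card (z \<union> (D - w)) = card z + card (D - w)"
        using w z finz finD by (intro card_Un_disjoint) auto
      then show "card (z \<union> (D - w)) = card z + (card D - card w)"
        using w by (simp add: card_Diff_subset)
      show "card w \<le> card D" using w finD card_mono by blast
      show "(z \<union> w) - (z \<union> (D - w)) = w" using w z by auto
    qed
    show "(\<Sum>w\<in>Pow D. f (z \<union> w) (z \<union> (D - w))) \<le> (\<Sum>w\<in>Pow D. g (z \<union> w) (z \<union> (D - w)))"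
    \<comment> \<open>A nonzero term of \<open>f\<close> has \<open>card z + card w\<close> = i - 1
      and \<open>card z + card D - card w\<close> = i + 1. Adding these gives \<open>card D\<close>
      = 2k with k = i - \<open>card z\<close>, and the first forces k \<ge> 1. All other choices of
      D and z contribute zero to the left side and a nonnegative amount to the right.\<close>
    proof (cases "\<exists>k\<ge>1. card D = 2 * k \<and> card z + k = i")
      case False
      have "f (z \<union> w) (z \<union> (D - w)) = 0" if "w \<in> Pow D" for w
      proof (rule ccontr)
        assume "f (z \<union> w) (z \<union> (D - w)) \<noteq> 0"
        then have "card z + card w = i - 1" "card z + (card D - card w) = i + 1"
          by (auto simp: f_def c1[OF that] c2[OF that] split: if_splits)
        then have "card D = 2 * (i - card z) \<and> card z + (i - card z) = i \<and> i - card z \<ge> 1"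
          using c3[OF that] assms(3) by auto
        then show False using False by blast
      qed
      then show ?thesis by (simp add: sum_nonneg gnn)
    next
      case True
      then obtain k where k: "k \<ge> 1" "card D = 2 * k" "card z + k = i" by blast
      let ?q = "\<lambda>w. p (z \<union> w) * p (z \<union> (D - w))"
      have finPD: "finite (Pow D)" using finD by simp
      have lay: "(\<Sum>w\<in>Pow D. if card w = j then h w else 0) = (\<Sum>w | w \<subseteq> D \<and> card w = j. h w)"
        for h :: "'a set \<Rightarrow> real" and j
        using sum.inter_filter[OF finPD, of h "\<lambda>x. card x = j"] by simp
      \<comment> \<open>Since \<open>card z + k = i\<close>, layers i - 1 and i + 1 correspond to
        \<open>card w = k - 1\<close>, while layer i corresponds to
        \<open>card w = k\<close>.\<close>
      have "(\<Sum>w\<in>Pow D. f (z \<union> w) (z \<union> (D - w))) = (\<Sum>w\<in>Pow D. if card w = k - 1 then ?q w else 0)"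
        using k c1 c2 c3 by (intro sum.cong refl) (auto simp: f_def)
      also have "\<dots> = (\<Sum>w | w \<subseteq> D \<and> card w = k - 1. ?q w)" by (rule lay)
      also have "\<dots> \<le> real k / real (k + 1) * (\<Sum>w | w \<subseteq> D \<and> card w = k. ?q w)"
        using pairs[OF D z k(2,1)] by (simp add: field_simps)
      also have "\<dots> = (\<Sum>w\<in>Pow D. if card w = k then real k / real (k + 1) * ?q w else 0)"
        by (simp only: lay sum_distrib_left)
      also have "\<dots> = (\<Sum>w\<in>Pow D. g (z \<union> w) (z \<union> (D - w)))"
      proof (intro sum.cong refl)
        fix w assume w: "w \<in> Pow D"
        show "(if card w = k then real k / real (k + 1) * ?q w else 0) = g (z \<union> w) (z \<union> (D - w))"
          using k c3[OF w] unfolding g_def c1[OF w] c2[OF w] c4[OF w]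
          by (auto simp: field_simps)
      qed
      finally show ?thesis .
    qed
  qed
  also have "\<dots> = (\<Sum>x\<in>?L. \<Sum>y\<in>?L. p x * p y)
      - (\<Sum>x\<in>?L. \<Sum>y\<in>?L. p x * p y / (real (card (x - y)) + 1))"
    unfolding g_def layer2 by (simp add: sum_subtractf algebra_simps)
  also have "\<dots> \<le> (a i)\<^sup>2 - real (n + 1) / (real (i + 1) * real (n + 1 - i)) * (a i)\<^sup>2"
    using inverse_distance_form_lower_bound[of S n i p] assms(1,2,4)
    by (simp add: a_def power2_eq_square sum_product)
  also have "\<dots> = real i * real (n - i) / (real (i + 1) * real (n - i + 1)) * (a i)\<^sup>2"
  proof -
    \<comment> \<open>With m = n - i the claim rests on (i + 1)(m + 1) - (i + m + 1) = i m.\<close>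
    obtain m where n: "n = i + m" using assms(4) less_imp_add_positive by blast
    have "1 - (real i + real m + 1) / ((real i + 1) * (real m + 1))
        = real i * real m / ((real i + 1) * (real m + 1))"
      by (simp add: divide_simps) (simp add: algebra_simps)
    then have "(1 - real (n + 1) / (real (i + 1) * real (n + 1 - i))) * (a i)\<^sup>2
        = real i * real (n - i) / (real (i + 1) * real (n - i + 1)) * (a i)\<^sup>2"
      by (simp add: n add_ac)
    then show ?thesis by (simp only: left_diff_distrib mult_1_left)
  qed
  finally show ?thesis .
qed

section \<open>Sets as configurations, and conditioning\<close>

text \<open>Indicator function cut down to \<open>S\<close>, so that it is extensional and lies in
  \<open>cube S\<close>. The explicit ground set lets the same encoding serve for full
  configurations, for the values fixed off D, and for configurations on D.\<close>

definition indic :: "'a set \<Rightarrow> 'a set \<Rightarrow> 'a \<Rightarrow> nat" where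
  "indic S x = (\<lambda>i\<in>S. of_bool (i \<in> x))"

lemma indic_in_cube: "indic S x \<in> cube S"
  by (auto simp: indic_def cube_def of_bool_def)

lemma bij_betw_indic: "bij_betw (indic S) (Pow S) (cube S)"
proof (rule bij_betw_byWitness[where f' = "\<lambda>\<eta>. {i \<in> S. \<eta> i = 1}"])
  show "\<forall>\<eta>\<in>cube S. indic S {i \<in> S. \<eta> i = 1} = \<eta>"
    by (auto simp: indic_def cube_def fun_eq_iff PiE_def extensional_def Pi_def)
qed (auto simp: indic_in_cube, auto simp: indic_def split: split_of_bool_asm)

lemma weight_indic:
  assumes "finite S" "x \<subseteq> S"
  shows "weight S (indic S x) = card x"
proof -
  have "{i \<in> S. i \<in> x} = x" using assms(2) by auto
  then show ?thesis
    using assms(1) by (simp add: weight_def indic_def of_bool_def flip: sum.inter_filter)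
qed

lemma antipode_indic: "antipode S (indic S x) = indic S (S - x)"
  by (auto simp: antipode_def indic_def fun_eq_iff)

lemma sum_layer_indic:
  fixes F :: "('a \<Rightarrow> nat) \<Rightarrow> real"
  assumes "finite S"
  shows "(\<Sum>\<eta> | \<eta> \<in> cube S \<and> weight S \<eta> = j. F \<eta>) = (\<Sum>x | x \<subseteq> S \<and> card x = j. F (indic S x))"
proof (rule sum.reindex_bij_betw[symmetric])
  have "indic S ` {x. x \<subseteq> S \<and> card x = j} = {\<eta>. \<eta> \<in> cube S \<and> weight S \<eta> = j}"
  proof (intro equalityI subsetI)
    fix \<eta> assume \<eta>: "\<eta> \<in> {\<eta>. \<eta> \<in> cube S \<and> weight S \<eta> = j}"
    then have "\<eta> \<in> indic S ` Pow S"
      using bij_betw_imp_surj_on[OF bij_betw_indic[of S]] by simp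
    then obtain x where "x \<subseteq> S" "\<eta> = indic S x" by auto
    with \<eta> show "\<eta> \<in> indic S ` {x. x \<subseteq> S \<and> card x = j}"
      using weight_indic[OF assms] by auto
  qed (use weight_indic[OF assms] indic_in_cube in auto)
  then show "bij_betw (indic S) {x. x \<subseteq> S \<and> card x = j} {\<eta>. \<eta> \<in> cube S \<and> weight S \<eta> = j}"
    using bij_betw_imp_inj_on[OF bij_betw_indic[of S]]
    by (auto simp: bij_betw_def intro: inj_on_subset)
qed

lemma finite_cube: "finite S \<Longrightarrow> finite (cube S)"
  by (simp add: cube_def finite_PiE)

lemma rank_sequence_indic:
  assumes "finite S"
  shows "rank_sequence S \<mu> j = (\<Sum>x | x \<subseteq> S \<and> card x = j. pmf \<mu> (indic S x))"
  using sum_layer_indic[OF assms] finite_cube[OF assms]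
  by (simp add: rank_sequence_def measure_measure_pmf_finite)

text \<open>Within the cylinder that fixes z off D, exactly one configuration restricts to w on D,
  namely the one of z \<union> w. So conditioning only divides its mass by that of the
  cylinder.\<close>

lemma pmf_conditional_indic:
  assumes "D \<subseteq> S" "z \<subseteq> S - D" "w \<subseteq> D"
    and "measure_pmf.prob \<mu> (cylinder S (S - D) (indic (S - D) z)) > 0"
  shows "pmf (conditional S (S - D) (indic (S - D) z) \<mu>) (indic D w)
    = pmf \<mu> (indic S (z \<union> w)) / measure_pmf.prob \<mu> (cylinder S (S - D) (indic (S - D) z))"
proof -
  let ?C = "cylinder S (S - D) (indic (S - D) z)"
  let ?M = "cond_pmf \<mu> ?C"
  have ne: "set_pmf \<mu> \<inter> ?C \<noteq> {}"
    using assms(4) by (auto simp: measure_pmf_zero_iff zero_less_measure_iff)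
  have SD: "S - (S - D) = D" using assms(1) by auto
  have inC: "indic S (z \<union> w) \<in> ?C"
    using assms by (auto simp: cylinder_def indic_in_cube) (auto simp: indic_def)
  have eq: "(\<lambda>\<eta>. restrict \<eta> D) -` {indic D w} \<inter> ?C = {indic S (z \<union> w)}"
  proof (intro equalityI subsetI)
    fix \<eta> assume "\<eta> \<in> (\<lambda>\<eta>. restrict \<eta> D) -` {indic D w} \<inter> ?C"
    then have r: "restrict \<eta> D = indic D w" and c: "\<eta> \<in> cube S" "\<forall>i\<in>S - D. \<eta> i = indic (S - D) z i"
      by (auto simp: cylinder_def)
    have "\<eta> i = indic S (z \<union> w) i" for i
    proof -
      consider "i \<in> D" | "i \<in> S - D" | "i \<notin> S" by blast
      then show ?thesis
      proof cases
        case 1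
        then have "\<eta> i = indic D w i" using fun_cong[OF r, of i] by simp
        then show ?thesis using 1 assms(1-3) by (auto simp: indic_def)
      next
        case 2
        then show ?thesis using c(2) assms(1-3) by (auto simp: indic_def)
      next
        case 3
        then show ?thesis using c(1) by (auto simp: cube_def indic_def PiE_def extensional_def)
      qed
    qed
    then show "\<eta> \<in> {indic S (z \<union> w)}" by auto
  next
    fix \<eta> assume "\<eta> \<in> {indic S (z \<union> w)}"
    then show "\<eta> \<in> (\<lambda>\<eta>. restrict \<eta> D) -` {indic D w} \<inter> ?C"
      using inC assms(1-3) by simp (auto simp: indic_def fun_eq_iff)
  qed
  have "pmf (conditional S (S - D) (indic (S - D) z) \<mu>) (indic D w)
      = measure_pmf.prob ?M ((\<lambda>\<eta>. restrict \<eta> D) -` {indic D w})"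
    by (simp add: conditional_def SD pmf_map)
  \<comment> \<open>The conditioned measure is supported in the cylinder, so intersecting with it
    loses no mass; this cuts the preimage down to a single point.\<close>
  also have "\<dots> = measure_pmf.prob ?M ((\<lambda>\<eta>. restrict \<eta> D) -` {indic D w} \<inter> ?C)"
    using set_cond_pmf[OF ne] by (intro measure_prob_cong_0) (auto simp: pmf_eq_0_set_pmf)
  also have "\<dots> = pmf ?M (indic S (z \<union> w))"
    unfolding eq by (simp add: measure_pmf_single)
  also have "\<dots> = pmf \<mu> (indic S (z \<union> w)) / measure_pmf.prob \<mu> ?C"
    using inC by (simp add: pmf_cond[OF ne])
  finally show ?thesis .
qed

text \<open>The antipode of w inside D is D - w, so each antipodal average of the conditioned
  measure is a sum \<open>?A j\<close> divided by C(2k, j) and by the squared mass of the cylinder.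
  That square cancels from the APP, leaving an inequality between unconditioned masses.\<close>

lemma CAPP_imp_antipodal_sums:
  assumes "finite S" "CAPP S \<mu>" "D \<subseteq> S" "z \<subseteq> S - D" "card D = 2 * k" "k \<ge> 1"
  defines "p \<equiv> \<lambda>x. pmf \<mu> (indic S x)"
  shows "real (k + 1) * (\<Sum>w | w \<subseteq> D \<and> card w = k - 1. p (z \<union> w) * p (z \<union> (D - w)))
    \<le> real k * (\<Sum>w | w \<subseteq> D \<and> card w = k. p (z \<union> w) * p (z \<union> (D - w)))"
proof -
  let ?C = "cylinder S (S - D) (indic (S - D) z)"
  let ?m = "measure_pmf.prob \<mu> ?C"
  let ?A = "\<lambda>j. \<Sum>w | w \<subseteq> D \<and> card w = j. p (z \<union> w) * p (z \<union> (D - w))"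
  have finD: "finite D" using assms finite_subset by blast
  show ?thesis
  proof (cases "?m > 0")
    case False
    have "p (z \<union> w) = 0" if "w \<subseteq> D" for w
    proof -
      have "indic S (z \<union> w) \<in> ?C"
        using that assms by (auto simp: cylinder_def indic_in_cube) (auto simp: indic_def)
      then have "p (z \<union> w) \<le> ?m"
        unfolding p_def measure_pmf_single[symmetric] by (intro measure_pmf.finite_measure_mono) auto
      with False show ?thesis unfolding p_def by (metis pmf_nonneg order.trans order.antisym not_less)
    qed
    then show ?thesis by simp
  next
    case True
    let ?\<nu> = "conditional S (S - D) (indic (S - D) z) \<mu>"
    have SD: "S - (S - D) = D" using assms by auto
    have "card (S - D) + 2 * k = card S"
      using assms finD card_mono[of S D] by (simp add: card_Diff_subset)
    then have "APP D ?\<nu>"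
      using assms(2) True indic_in_cube[of "S - D" z] unfolding CAPP_def
      by (metis Diff_subset SD)
    then have app: "antipodal_avg D ?\<nu> (k - 1) \<le> antipodal_avg D ?\<nu> k"
      using assms(5) by (auto simp: APP_def)
    have avg: "antipodal_avg D ?\<nu> j = ?A j / ?m\<^sup>2 / real ((2 * k) choose j)" for j
    proof -
      have "(\<Sum>\<eta> | \<eta> \<in> cube D \<and> weight D \<eta> = j. pmf ?\<nu> \<eta> * pmf ?\<nu> (antipode D \<eta>))
        = (\<Sum>w | w \<subseteq> D \<and> card w = j. p (z \<union> w) * p (z \<union> (D - w)) / ?m\<^sup>2)"
        unfolding sum_layer_indic[OF finD] antipode_indic p_def
        using pmf_conditional_indic[OF assms(3,4) _ True]
        by (intro sum.cong refl) (simp add: power2_eq_square)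
      then show ?thesis by (simp add: antipodal_avg_def assms(5) sum_divide_distrib)
    qed
    let ?b = "real (2 * k choose k)" and ?b' = "real (2 * k choose (k - 1))"
    have pos: "?b > 0" "?b' > 0" by (auto simp: zero_less_binomial_iff)
    \<comment> \<open>Ratio of the central binomial coefficient to its neighbour; the source of the
      factors k and k + 1.\<close>
    have bin: "real k * ?b = real (k + 1) * ?b'"
    proof -
      obtain j where j: "k = Suc j" using assms(6) by (cases k) auto
      have "k * (2 * k choose k) = (2 * k - j) * (2 * k choose j)"
        using binomial_absorb_comp[of "2 * k" j] binomial_absorption[of j "2 * k"]
        by (simp add: j)
      moreover have "2 * k - j = k + 1" using j by simp
      ultimately show ?thesis using j by (metis diff_Suc_1 of_nat_mult)
    qed
    have "?A (k - 1) / ?b' / ?m\<^sup>2 \<le> ?A k / ?b / ?m\<^sup>2"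
      using app unfolding avg by (simp add: field_simps)
    moreover have "?m\<^sup>2 > 0" using True by simp
    ultimately have "?A (k - 1) / ?b' \<le> ?A k / ?b"
      by (simp only: divide_le_cancel)
    then have "?A (k - 1) * ?b \<le> ?A k * ?b'"
      using pos by (simp add: field_simps)
    then have "real k * (?A (k - 1) * ?b) \<le> real k * (?A k * ?b')"
      by (rule mult_left_mono) simp
    moreover have "real k * (?A (k - 1) * ?b) = ?b' * (real (k + 1) * ?A (k - 1))"
      using arg_cong[OF bin, of "\<lambda>t. t * ?A (k - 1)"] by (simp only: mult_ac)
    ultimately have "?b' * (real (k + 1) * ?A (k - 1)) \<le> ?b' * (real k * ?A k)"
      by (simp only: mult_ac)
    then show ?thesis using pos by (simp only: mult_le_cancel_left_pos)
  qed
qed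

section \<open>Ultra-log-concavity of the rank sequence\<close>

text \<open>The constant equals C(n, i - 1) C(n, i + 1) / C(n, i)^2, because C(n, i - 1) = i C(n, i)
  / (n - i + 1) and C(n, i + 1) = (n - i) C(n, i) / (i + 1).\<close>

lemma ULC_ratio_step:
  fixes x y z :: real
  assumes "1 \<le> i" "i < n"
    and "x * z \<le> real i * real (n - i) / (real (i + 1) * real (n - i + 1)) * y\<^sup>2"
  shows "x / real (n choose (i - 1)) * (z / real (n choose (i + 1))) \<le> (y / real (n choose i))\<^sup>2"
proof -
  obtain j where i: "i = Suc j" using assms(1) by (cases i) auto
  let ?b = "real (n choose i)" and ?l = "real (n choose (i - 1))" and ?u = "real (n choose (i + 1))"
  have pos: "?b > 0" "?l > 0" "?u > 0" using assms by (auto simp: zero_less_binomial_iff)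
  have rec: "real (Suc t) * real (n choose Suc t) = real (n - t) * real (n choose t)" for t
    using binomial_absorb_comp[of n t] binomial_absorption[of t n] by (metis of_nat_mult)
  have "real i * ?b = real (n - i + 1) * ?l"
    using rec[of j] assms(2) i by (simp add: of_nat_diff)
  then have l: "?l = real i * ?b / real (n - i + 1)" by (simp add: field_simps)
  have "real (i + 1) * ?u = real (n - i) * ?b"
    using rec[of i] by simp
  then have u: "?u = real (n - i) * ?b / real (i + 1)" by (simp add: field_simps)
  have "x * z / (?l * ?u) \<le> real i * real (n - i) / (real (i + 1) * real (n - i + 1)) * y\<^sup>2 / (?l * ?u)"
    using assms(3) pos by (intro divide_right_mono) auto
  also have "\<dots> = (y / ?b)\<^sup>2"
    unfolding l u using assms(1,2) pos by (simp add: power2_eq_square)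
  finally show ?thesis by simp
qed

theorem theorem1p1:
  fixes n :: nat and \<mu> :: "(nat \<Rightarrow> nat) pmf"
  assumes "n \<ge> 1"
    and "\<mu> \<in> prob_measures {1..n}"
    and "no_internal_zeros n (rank_sequence {1..n} \<mu>)"
    and "CAPP {1..n} \<mu>"
  shows "ULC {1..n} \<mu>"
proof -
  let ?S = "{1..n}"
  let ?r = "rank_sequence ?S \<mu>"
  have "?r (i - 1) / real (n choose (i - 1)) * (?r (i + 1) / real (n choose (i + 1)))
      \<le> (?r i / real (n choose i))\<^sup>2" if "i \<in> {1..<n}" for i
    using that layers_ultra_log_concave[of ?S n i "\<lambda>x. pmf \<mu> (indic ?S x)"]
      CAPP_imp_antipodal_sums[OF _ assms(4)]
    by (intro ULC_ratio_step) (auto simp: rank_sequence_indic)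
  \<comment> \<open>Binomials with i \<le> n are nonzero, so normalising preserves the support and
    hence the absence of internal zeros.\<close>
  moreover have "{i \<in> {0..n}. ?r i / real (n choose i) \<noteq> 0} = {i \<in> {0..n}. ?r i \<noteq> 0}"
    by auto
  ultimately show ?thesis
    using assms(3) by (simp add: ULC_def ULC_seq_def log_concave_seq_def no_internal_zeros_def)
qed

end
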